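(* Let $G$ be a $d$-regular graph with $n\geq 2$ vertices. Then $\mathsf{wd}(G)\geq d-\sqrt{2n}$.
   Context: All graphs are finite and simple; $\mathbb{N}=\{0,1,2,\ldots\}$. Weak degeneracy: let $G$ be a graph and $f\colon V(G)\to\mathbb{N}$. For a vertex $u$, the operation $\mathrm{Delete}(G,f,u)$ outputs $G'=G-u$ and $f'\colon V(G')\to\mathbb{Z}$ with $f'(v)=f(v)-1$ if $uv\in E(G)$ and $f'(v)=f(v)$ otherwise; its application is legal if $f'(v)\geq 0$ for all $v\in V(G')$. For adjacent vertices $u,w$, the operation $\mathrm{DelSave}(G,f,u,w)$ outputs $G'=G-u$ and $f'\colon V(G')\to\mathbb{Z}$ with $f'(v)=f(v)-1$ if $uv\in E(G)$ and $v\neq w$, and $f'(v)=f(v)$ otherwise; its application is legal if $f(u)>f(w)$ and $f'$ is non-negative. $G$ is weakly $f$-degenerate if all vertices of $G$ can be removed by a sequence of legal applications of Delete and DelSave, starting with $(G,f)$. For $d\in\mathbb{N}$, $G$ is weakly $d$-degenerate if it is weakly degenerate with respect to the constant $d$ function. The weak degeneracy $\mathsf{wd}(G)$ is the minimum $d$ such that $G$ is weakly $d$-degenerate. *)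

theory Defs
  imports Complex_Main "Graph_Theory.Digraph"
begin

text \<open>
  Finite simple graphs are the locale \<^locale>\<open>graph\<close>: finite symmetric digraphs without loops and
  without parallel arcs. Each edge is represented by its two opposite arcs, so the degree of a vertex
  is its out-degree, and adjacency is \<^const>\<open>dominates\<close>.
\<close>

definition regular :: "nat \<Rightarrow> ('a, 'b) pre_digraph \<Rightarrow> bool" where
  "regular d G \<longleftrightarrow> (\<forall>v \<in> verts G. out_degree G v = d)"

text \<open>
  A configuration is a graph together with an integer-valued function on its vertices. The function
  is total on the vertex type; its values outside the current vertex set are irrelevant.
\<close>

type_synonym ('a, 'b) config = "('a, 'b) pre_digraph \<times> ('a \<Rightarrow> int)"

definition Delete :: "('a, 'b) pre_digraph \<Rightarrow> ('a \<Rightarrow> int) \<Rightarrow> 'a \<Rightarrow> ('a, 'b) config" where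
  "Delete G f u =
     (pre_digraph.del_vert G u, \<lambda>v. if u \<rightarrow>\<^bsub>G\<^esub> v then f v - 1 else f v)"

definition DelSave :: "('a, 'b) pre_digraph \<Rightarrow> ('a \<Rightarrow> int) \<Rightarrow> 'a \<Rightarrow> 'a \<Rightarrow> ('a, 'b) config" where
  "DelSave G f u w =
     (pre_digraph.del_vert G u, \<lambda>v. if u \<rightarrow>\<^bsub>G\<^esub> v \<and> v \<noteq> w then f v - 1 else f v)"

definition nonneg_config :: "('a, 'b) config \<Rightarrow> bool" where
  "nonneg_config C \<longleftrightarrow> (\<forall>v \<in> verts (fst C). 0 \<le> snd C v)"

inductive legal_step :: "('a, 'b) config \<Rightarrow> ('a, 'b) config \<Rightarrow> bool" where
  delete: "legal_step (G, f) (Delete G f u)"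
    if "u \<in> verts G" and "nonneg_config (Delete G f u)"
| del_save: "legal_step (G, f) (DelSave G f u w)"
    if "u \<in> verts G" and "w \<in> verts G" and "u \<rightarrow>\<^bsub>G\<^esub> w"
      and "f w < f u" and "nonneg_config (DelSave G f u w)"

definition weakly_degenerate :: "('a, 'b) pre_digraph \<Rightarrow> ('a \<Rightarrow> nat) \<Rightarrow> bool" where
  "weakly_degenerate G f \<longleftrightarrow>
     (\<exists>H g. legal_step\<^sup>*\<^sup>* (G, \<lambda>v. int (f v)) (H, g) \<and> verts H = {})"

definition wd :: "('a, 'b) pre_digraph \<Rightarrow> nat" where
  "wd G = (LEAST d. weakly_degenerate G (\<lambda>_. d))"

text \<open>The minimum defining \<^const>\<open>wd\<close> is over a nonempty set and hence attained.\<close>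

lemma legal_steps_to_empty:
  assumes "finite (verts G)" and "\<forall>v \<in> verts G. int (card (verts G)) \<le> f v"
  shows "\<exists>H g. legal_step\<^sup>*\<^sup>* (G, f) (H, g) \<and> verts H = {}"
  using assms
proof (induction "card (verts G)" arbitrary: G f)
  case 0
  then show ?case by auto
next
  case (Suc n)
  then obtain u where u: "u \<in> verts G" by fastforce
  obtain G' f' where D: "Delete G f u = (G', f')" by (cases "Delete G f u")
  have G': "verts G' = verts G - {u}"
    using D by (auto simp: Delete_def pre_digraph.del_vert_def)
  have c: "card (verts G') = n"
    using Suc.hyps(2) Suc.prems(1) u by (simp add: G')
  have f': "\<forall>v \<in> verts G'. int n \<le> f' v"
    using D Suc.prems(2) Suc.hyps(2)[symmetric] by (fastforce simp: G' Delete_def)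
  then have "nonneg_config (Delete G f u)"
    unfolding D nonneg_config_def by fastforce
  then have "legal_step (G, f) (G', f')"
    using legal_step.delete[OF u] D by metis
  moreover have "\<exists>H g. legal_step\<^sup>*\<^sup>* (G', f') (H, g) \<and> verts H = {}"
    using Suc.hyps(1)[of G' f'] c f' Suc.prems(1) G' by simp
  ultimately show ?case by (meson converse_rtranclp_into_rtranclp)
qed

lemma weakly_degenerate_wd:
  assumes "graph G"
  shows "weakly_degenerate G (\<lambda>_. wd G)"
proof -
  interpret graph G by fact
  have "weakly_degenerate G (\<lambda>_. card (verts G))"
    unfolding weakly_degenerate_def by (rule legal_steps_to_empty) simp_all
  then show ?thesis unfolding wd_def by (rule LeastI)
qed

end

theory Submission
  imports Defs
begin

text \<open>
  Put \<open>s = d - k\<close>, where \<open>k = wd G\<close> may be taken smaller than \<open>d\<close>, and follow a removal sequence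
  that starts from the constant function \<open>k\<close>. Deleting a vertex lowers both the remaining degree and
  the value of \<open>f\<close> at each of its neighbours by one, except that a DelSave spares the value at one
  chosen neighbour. So the \<^emph>\<open>slack\<close> \<open>f v + s - deg v\<close> of a remaining vertex \<open>v\<close> starts at \<open>0\<close> and
  counts how often \<open>v\<close> has been saved. When only \<open>j + 1\<close> vertices remain, each of them has degree at
  most \<open>j\<close> while its value is still non-negative, so the next vertex to go has been saved at least
  \<open>s - j\<close> times. Over the last \<open>s\<close> vertices (there are that many, since \<open>s \<le> d < n\<close>) this adds up to
  at least \<open>1 + \<dots> + s = s (s + 1) / 2\<close> saves. But each of the \<open>n\<close> removals saves at most one vertex,
  whence \<open>s\<^sup>2 \<le> s (s + 1) \<le> 2 n\<close>.

  The count is carried out in \<open>slack_sum_lower_bound\<close>, by induction along the removal sequence; the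
  effect of one removal is the content of \<open>legal_step_value\<close> and \<open>out_degree_del_vert\<close>.
\<close>

lemma graph_del_vert:
  assumes "graph G"
  shows "graph (pre_digraph.del_vert G u)"
proof -
  interpret graph G by fact
  interpret H: fin_digraph "del_vert u" by (rule fin_digraph_del_vert)
  show ?thesis
  proof
    show "tail (del_vert u) e \<noteq> head (del_vert u) e" if "e \<in> arcs (del_vert u)" for e
      using that no_loops by (auto simp: del_vert_simps)
    show "e1 = e2" if "e1 \<in> arcs (del_vert u)" "e2 \<in> arcs (del_vert u)"
      "arc_to_ends (del_vert u) e1 = arc_to_ends (del_vert u) e2" for e1 e2
      using that no_multi_arcs by (auto simp: del_vert_simps ends_del_vert)
    show "symmetric (del_vert u)"
    proof (unfold symmetric_def, rule symI)
      fix a b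
      have ends: "x \<rightarrow>\<^bsub>del_vert u\<^esub> y \<longleftrightarrow> x \<rightarrow>\<^bsub>G\<^esub> y \<and> x \<noteq> u \<and> y \<noteq> u" for x y
        by (auto simp: arcs_ends_def arc_to_ends_def del_vert_simps)
      have "sym (arcs_ends G)" using sym_arcs by (simp add: symmetric_def)
      then show "b \<rightarrow>\<^bsub>del_vert u\<^esub> a" if "a \<rightarrow>\<^bsub>del_vert u\<^esub> b"
        using that unfolding ends by (meson symD)
    qed
  qed
qed

text \<open>
  Without parallel arcs, an arc leaving \<open>v\<close> is determined by its head, so degrees count neighbours.
\<close>

lemma (in digraph) out_degree_eq_card_neighbours:
  "out_degree G v = card {x. v \<rightarrow>\<^bsub>G\<^esub> x}"
proof -
  have "inj_on (head G) (out_arcs G v)"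
    using no_multi_arcs by (auto simp: inj_on_def arc_to_ends_def)
  moreover have "head G ` out_arcs G v = {x. v \<rightarrow>\<^bsub>G\<^esub> x}"
    by (auto simp: arcs_ends_def arc_to_ends_def)
  ultimately show ?thesis
    unfolding out_degree_def by (metis card_image)
qed

lemma (in digraph) finite_neighbours: "finite {x. v \<rightarrow>\<^bsub>G\<^esub> x}"
  by (rule finite_subset[OF _ finite_verts]) (auto dest: adj_in_verts)

lemma (in digraph) out_degree_less_card_verts:
  assumes "v \<in> verts G"
  shows "out_degree G v < card (verts G)"
proof -
  have "{x. v \<rightarrow>\<^bsub>G\<^esub> x} \<subseteq> verts G - {v}"
    by (auto simp: arcs_ends_def arc_to_ends_def dest: no_loops)
  then have "{x. v \<rightarrow>\<^bsub>G\<^esub> x} \<subset> verts G" using assms by blast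
  then show ?thesis
    unfolding out_degree_eq_card_neighbours by (intro psubset_card_mono) simp_all
qed

lemma out_degree_del_vert:
  assumes "graph G" and "v \<noteq> u"
  shows "out_degree G v =
    out_degree (pre_digraph.del_vert G u) v + (if u \<rightarrow>\<^bsub>G\<^esub> v then 1 else 0)"
proof -
  interpret graph G by fact
  interpret H: graph "del_vert u" by (rule graph_del_vert) fact
  have sym: "u \<rightarrow>\<^bsub>G\<^esub> v \<longleftrightarrow> v \<rightarrow>\<^bsub>G\<^esub> u"
    using sym_arcs unfolding symmetric_def by (meson symD)
  have "{x. v \<rightarrow>\<^bsub>del_vert u\<^esub> x} = {x. v \<rightarrow>\<^bsub>G\<^esub> x} - {u}"
    using \<open>v \<noteq> u\<close> by (auto simp: arcs_ends_def arc_to_ends_def del_vert_simps)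
  then show ?thesis
    unfolding out_degree_eq_card_neighbours H.out_degree_eq_card_neighbours sym
    using card_Suc_Diff1[OF finite_neighbours, of u v] by (cases "v \<rightarrow>\<^bsub>G\<^esub> u") simp_all
qed

text \<open>
  A common description of both kinds of step for the purpose of counting saves: \<open>w\<close> is the only vertex
  that can be saved. A plain deletion saves none, and there the removed vertex itself serves as \<open>w\<close>.
\<close>

lemma legal_step_value:
  assumes "legal_step (G, f) (G', f')"
  obtains u w where "u \<in> verts G" "G' = pre_digraph.del_vert G u" "nonneg_config (G', f')"
    "\<And>v. f v \<le> f' v + (if u \<rightarrow>\<^bsub>G\<^esub> v then 1 else 0)"
    "\<And>v. f' v + (if u \<rightarrow>\<^bsub>G\<^esub> v then 1 else 0) \<le> f v + (if v = w then 1 else 0)"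
  using assms
proof (cases rule: legal_step.cases)
  case (delete u)
  then show ?thesis
    by (intro that[of u u]) (auto simp: Delete_def)
next
  case (del_save u w)
  then show ?thesis
    by (intro that[of u w]) (auto simp: DelSave_def)
qed

text \<open>
  The slack of \<open>v\<close> is at least \<open>s - j\<close> when \<open>v\<close> is removed with \<open>j\<close> other vertices left. All these
  slacks together are at most the slack already present plus the number of saves still to come, which
  is at most \<open>card (verts G)\<close>. The truncated difference \<open>s - j\<close> covers the early removals too,
  for which the bound on the slack is just its non-negativity.
\<close>

lemma slack_sum_lower_bound:
  assumes "legal_step\<^sup>*\<^sup>* (G, f) (H, g)" and "verts H = {}"
    and "graph G" and "nonneg_config (G, f)"
    and "\<And>v. v \<in> verts G \<Longrightarrow> int (out_degree G v) \<le> f v + int s"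
  shows "(\<Sum>j<card (verts G). int (s - j)) \<le>
    int (card (verts G)) + (\<Sum>v\<in>verts G. f v + int s - int (out_degree G v))"
  using assms
proof (induction "(G, f)" arbitrary: G f rule: converse_rtranclp_induct)
  case base
  then show ?case by simp
next
  case (step C)
  obtain G' f' where C: "C = (G', f')" by (cases C)
  obtain u w where u: "u \<in> verts G" and G': "G' = pre_digraph.del_vert G u"
    and nonneg: "nonneg_config (G', f')"
    and lower: "\<And>v. f v \<le> f' v + (if u \<rightarrow>\<^bsub>G\<^esub> v then 1 else 0)"
    and upper: "\<And>v. f' v + (if u \<rightarrow>\<^bsub>G\<^esub> v then 1 else 0) \<le> f v + (if v = w then 1 else 0)"
    using step.hyps(1) unfolding C by (rule legal_step_value) blast
  interpret graph G by (rule step.prems(2))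
  define slack where "slack v = f v + int s - int (out_degree G v)" for v
  define slack' where "slack' v = f' v + int s - int (out_degree G' v)" for v
  have verts': "verts G' = verts G - {u}" by (simp add: G' verts_del_vert)
  have fin': "finite (verts G')" by (simp add: verts')
  have card: "card (verts G) = Suc (card (verts G'))"
    unfolding verts' using card_Suc_Diff1[OF finite_verts u] by simp
  have deg: "int (out_degree G v) = int (out_degree G' v) + (if u \<rightarrow>\<^bsub>G\<^esub> v then 1 else 0)"
    if "v \<in> verts G'" for v
    using out_degree_del_vert[OF step.prems(2), of v u] that by (auto simp: G' verts_del_vert)
  have slack_mono: "slack v \<le> slack' v" if "v \<in> verts G'" for v
    using lower[of v] deg[OF that] by (simp add: slack_def slack'_def)
  have slack_step: "slack' v \<le> slack v + (if v = w then 1 else 0)" if "v \<in> verts G'" for v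
    using upper[of v] deg[OF that] unfolding slack_def slack'_def by linarith
  have slack_nonneg: "0 \<le> slack v" if "v \<in> verts G" for v
    using step.prems(4)[OF that] by (simp add: slack_def)
  have "int (out_degree G' v) \<le> f' v + int s" if v: "v \<in> verts G'" for v
  proof -
    have "0 \<le> slack v" using v by (intro slack_nonneg) (simp add: verts')
    also have "\<dots> \<le> slack' v" using v by (rule slack_mono)
    finally show ?thesis by (simp add: slack'_def)
  qed
  then have "(\<Sum>j<card (verts G'). int (s - j)) \<le> int (card (verts G')) + (\<Sum>v\<in>verts G'. slack' v)"
    unfolding slack'_def using graph_del_vert[OF step.prems(2)] step.prems(1) nonneg
    by (intro step.hyps(3)[OF C]) (simp_all add: G')
  also have "(\<Sum>v\<in>verts G'. slack' v) \<le> (\<Sum>v\<in>verts G'. slack v + (if v = w then 1 else 0))"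
    by (intro sum_mono slack_step)
  also have "\<dots> \<le> (\<Sum>v\<in>verts G'. slack v) + 1"
    using fin' by (simp add: sum.distrib)
  finally have rest: "(\<Sum>j<card (verts G'). int (s - j)) \<le>
      int (card (verts G)) + (\<Sum>v\<in>verts G'. slack v)"
    by (simp add: card)
  have "0 \<le> f u" using step.prems(3) u by (simp add: nonneg_config_def)
  then have "int (s - card (verts G')) \<le> slack u"
    using out_degree_less_card_verts[OF u] slack_nonneg[OF u] unfolding slack_def card by linarith
  moreover have "(\<Sum>v\<in>verts G. slack v) = slack u + (\<Sum>v\<in>verts G'. slack v)"
    unfolding verts' using u by (simp add: sum.remove)
  moreover have "(\<Sum>j<card (verts G). int (s - j)) =
      (\<Sum>j<card (verts G'). int (s - j)) + int (s - card (verts G'))"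
    by (simp add: card)
  ultimately show ?case using rest unfolding slack_def by linarith
qed

lemma sum_diff_gauss:
  assumes "s \<le> n"
  shows "2 * (\<Sum>j<n. int (s - j)) = int s * (int s + 1)"
proof -
  have "(\<Sum>j<n. int (s - j)) = (\<Sum>j<s. int (s - j))"
    using assms by (intro sum.mono_neutral_right) auto
  also have "\<dots> = (\<Sum>j<s. int (Suc j))"
    using sum.nat_diff_reindex[of "\<lambda>j. int (Suc j)" s] by (simp add: Suc_diff_Suc)
  also have "2 * \<dots> = int s * (int s + 1)"
    by (induction s) (simp_all add: algebra_simps)
  finally show ?thesis .
qed

theorem proposition1p8:
  fixes G :: "('a, 'b) pre_digraph" and d n :: nat
  assumes "graph G"
    and "regular d G"
    and "card (verts G) = n"
    and "n \<ge> 2"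
  shows "real (wd G) \<ge> real d - sqrt (2 * real n)"
proof (cases "d \<le> wd G")
  case True
  have "0 \<le> sqrt (2 * real n)" by simp
  with True show ?thesis by linarith
next
  case False
  interpret graph G by fact
  define s where "s = d - wd G"
  have deg: "out_degree G v = wd G + s" if "v \<in> verts G" for v
    using assms(2) False that by (simp add: regular_def s_def)
  obtain v where v: "v \<in> verts G" using assms(3,4) by fastforce
  have "s \<le> n"
    using out_degree_less_card_verts[OF v] deg[OF v] assms(3) by simp
  obtain H g where "legal_step\<^sup>*\<^sup>* (G, \<lambda>v. int (wd G)) (H, g)" "verts H = {}"
    using weakly_degenerate_wd[OF assms(1)] unfolding weakly_degenerate_def by blast
  then have "(\<Sum>j<card (verts G). int (s - j)) \<le>
      int (card (verts G)) + (\<Sum>v\<in>verts G. int (wd G) + int s - int (out_degree G v))"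
    using assms(1) by (rule slack_sum_lower_bound) (simp_all add: nonneg_config_def deg)
  also have "\<dots> = int n" by (simp add: deg assms(3))
  finally have "int s * (int s + 1) \<le> 2 * int n"
    using sum_diff_gauss[OF \<open>s \<le> n\<close>] assms(3) by simp
  then have "int (s\<^sup>2) \<le> int (2 * n)" by (simp add: power2_eq_square algebra_simps)
  then have "(real s)\<^sup>2 \<le> 2 * real n" by (metis of_nat_le_iff of_nat_mult of_nat_numeral of_nat_power)
  then have "real s \<le> sqrt (2 * real n)" by (rule real_le_rsqrt)
  then show ?thesis using False by (simp add: s_def)
qed

end
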